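(* Let $d$ be a squarefree integer such that the quadratic field $\mathbb{Q}(\sqrt{d})$ is norm-Euclidean, and let $\mathbb{D}[d]$ denote its ring of integers. Then there exists a finite set $\mathcal{E}_d \subset \mathbb{D}[d]$ such that for every $n \in \mathbb{D}[d] \setminus \mathcal{E}_d$ there exist nonzero $a, b, c \in \mathbb{D}[d]$ with $$\frac{4}{n} = \frac{1}{a} + \frac{1}{b} + \frac{1}{c}.$$
   Context: $\mathbb{D}[d]$ is the ring of integers of $\mathbb{Q}(\sqrt{d})$: it equals $\mathbb{Z}[\sqrt{d}]$ if $d \equiv 2,3 \pmod 4$ and $\mathbb{Z}[\tfrac{1+\sqrt{d}}{2}]$ if $d \equiv 1 \pmod 4$. The field $\mathbb{Q}(\sqrt{d})$ is norm-Euclidean if $\mathbb{D}[d]$ is a Euclidean domain with respect to the absolute value of the field norm. (Known classification: this holds exactly for $d \in \{-11,-7,-3,-2,-1,2,3,5,6,7,11,13,17,19,21,29,33,37,41,57,73\}$.) The equation is read in the field $\mathbb{Q}(\sqrt{d})$. *)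

theory Defs
  imports
    "HOL-Algebra.Ring_Divisibility"
    "HOL-Computational_Algebra.Squarefree"
    "HOL-Computational_Algebra.Polynomial"
    Complex_Main
begin

text \<open>Quadratic fields are realised as subfields of the complex numbers; for \<open>d < 0\<close> the
  root \<open>csqrt d\<close> is the purely imaginary \<open>\<i> * sqrt (-d)\<close>.\<close>

definition quad_field :: "int \<Rightarrow> complex set" where
  "quad_field d = {of_rat x + of_rat y * csqrt (of_int d) | x y. True}"

definition quad_ints :: "int \<Rightarrow> complex set" where
  "quad_ints d = {z \<in> quad_field d. algebraic_int z}"

text \<open>The field norm of \<open>x + y * sqrt d\<close> is the product \<open>x\<^sup>2 - d * y\<^sup>2\<close> of its two conjugates.
  The description is only meaningful when \<open>d\<close> is not a square, so that the rational coordinates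
  \<open>x\<close> and \<open>y\<close> are unique; see \<open>quad_norm_eq\<close> below.\<close>

definition quad_norm :: "int \<Rightarrow> complex \<Rightarrow> rat" where
  "quad_norm d z = (THE N. \<exists>x y. z = of_rat x + of_rat y * csqrt (of_int d)
     \<and> N = x\<^sup>2 - of_int d * y\<^sup>2)"

definition quad_int_ring :: "int \<Rightarrow> complex ring" where
  "quad_int_ring d = \<lparr>carrier = quad_ints d, mult = (*), one = 1, zero = 0, add = (+)\<rparr>"

text \<open>The norm of an algebraic integer is an integer, so the floor below only converts the type
  to the one that \<^locale>\<open>euclidean_domain\<close> expects of a Euclidean function.\<close>

definition norm_euclidean :: "int \<Rightarrow> bool" where
  "norm_euclidean d \<longleftrightarrow>
     euclidean_domain (quad_int_ring d) (\<lambda>z. nat \<lfloor>\<bar>quad_norm d z\<bar>\<rfloor>)"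

lemma squarefree_rat_square_eq_1:
  fixes d :: int and q :: rat
  assumes "squarefree d" "q\<^sup>2 = of_int d"
  shows "d = 1"
proof -
  obtain a b :: int where ab: "quotient_of q = (a, b)" by fastforce
  have q: "q = of_int a / of_int b" and b: "b > 0" and cop: "coprime a b"
    using quotient_of_div[OF ab] quotient_of_denom_pos[OF ab] quotient_of_coprime[OF ab] by auto
  have "of_int (a\<^sup>2) = (of_int (d * b\<^sup>2) :: rat)"
    using assms(2) b by (simp add: q power_divide field_simps)
  hence eq: "a\<^sup>2 = d * b\<^sup>2" by (simp only: of_int_eq_iff)
  hence "b\<^sup>2 dvd a\<^sup>2" by simp
  hence "b dvd a" by (simp only: pow_divides_pow_iff zero_less_numeral)
  hence "b dvd 1" by (rule coprime_common_divisor[OF cop]) simp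
  hence "b = 1" using b by simp
  hence "d = a\<^sup>2" using eq by simp
  moreover have "a dvd 1" by (rule squarefreeD[OF assms(1)]) (simp add: \<open>d = a\<^sup>2\<close>)
  ultimately show ?thesis by (metis one_power2 power2_abs zdvd1_eq)
qed

lemma quad_coords_unique:
  fixes d :: int and x y x' y' :: rat
  assumes "squarefree d" "d \<noteq> 1"
    and eq: "of_rat x + of_rat y * csqrt (of_int d) = of_rat x' + of_rat y' * csqrt (of_int d)"
  shows "x = x' \<and> y = y'"
proof -
  let ?s = "csqrt (of_int d)"
  have "y = y'"
  proof (rule ccontr)
    assume ne: "y \<noteq> y'"
    have "of_rat (y - y') * ?s = of_rat (x' - x)"
      using eq by (simp add: of_rat_diff algebra_simps)
    hence "?s = of_rat ((x' - x) / (y - y'))"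
      using ne by (simp add: of_rat_divide field_simps)
    hence "(of_rat ((x' - x) / (y - y')) :: complex)\<^sup>2 = of_int d"
      using power2_csqrt[of "of_int d"] by (simp only:)
    hence "(of_rat (((x' - x) / (y - y'))\<^sup>2) :: complex) = of_rat (of_int d)"
      by (simp only: of_rat_power of_rat_of_int_eq)
    hence "((x' - x) / (y - y'))\<^sup>2 = of_int d" by (simp only: of_rat_eq_iff)
    thus False using squarefree_rat_square_eq_1 assms by blast
  qed
  thus ?thesis using eq by simp
qed

lemma quad_norm_eq:
  fixes d :: int and x y :: rat
  assumes "squarefree d" "d \<noteq> 1"
  shows "quad_norm d (of_rat x + of_rat y * csqrt (of_int d)) = x\<^sup>2 - of_int d * y\<^sup>2"
  unfolding quad_norm_def
proof (rule the_equality)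
  fix N
  assume "\<exists>x' y'. of_rat x + of_rat y * csqrt (of_int d) = of_rat x' + of_rat y' * csqrt (of_int d)
    \<and> N = x'\<^sup>2 - of_int d * y'\<^sup>2"
  then obtain x' y' where
    "of_rat x + of_rat y * csqrt (of_int d) = of_rat x' + of_rat y' * csqrt (of_int d)"
    and N: "N = x'\<^sup>2 - of_int d * y'\<^sup>2" by auto
  from quad_coords_unique[OF assms this(1)] N show "N = x\<^sup>2 - of_int d * y\<^sup>2" by simp
qed auto

end

theory Submission
  imports Defs "HOL-Analysis.Kronecker_Approximation_Theorem"
begin

text \<open>
  If \<open>d > 0\<close>, Pell's equation \<open>x\<^sup>2 - 4 d y\<^sup>2 = 1\<close> has a solution with \<open>y \<noteq> 0\<close>, giving a unit
  \<open>u = x + 2 y \<surd>d\<close> with \<open>u - 1/u = 4 y \<surd>d\<close>; dividing by \<open>n y \<surd>d\<close> writes \<open>4/n\<close> as a sum of two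
  unit fractions, one of which is then halved.

  If \<open>d < 0\<close>, dividing \<open>\<surd>d\<close> or \<open>(1 + \<surd>d)/2\<close> by \<open>2\<close> with remainder leaves only the values
  \<open>d = -1, -2, -3, -7, -11\<close>, and for these every residue class modulo \<open>4\<close> falls under one of the
  identities (besides \<open>4/(2m) = 1/m + 1/(2m) + 1/(2m)\<close>)
  \<^item> \<open>4/n = 1/q + 1/(q + w) - w\<^sup>2/(n q (q + w))\<close> for \<open>n = 2q + w\<close> with \<open>w\<close> a unit,
  \<^item> \<open>4/n = 1/a - w/(n a)\<close> for \<open>n = 4a + w\<close> with \<open>w\<close> a divisor of \<open>4\<close>,
  \<^item> \<open>4/n = 1/a + 1/(a (\<theta>a - 1)) + s/(n (\<theta>a - 1))\<close> for \<open>n = 4a - r\<close> with \<open>\<theta> r = 4 + s\<close> and \<open>s\<close> a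
    divisor of \<open>n\<close>.
\<close>

section \<open>Pell's equation\<close>

text \<open>Infinitely many good approximations \<open>h/k\<close> of \<open>sqrt D\<close> give
  elements \<open>h + k sqrt D\<close> of bounded norm. The quotient of two of them with equal norm
  and congruent coordinates modulo that norm is integral of norm 1.\<close>

lemma pell_solution_exists:
  fixes D :: int
  assumes D: "D > 0" and irr: "sqrt (of_int D) \<notin> \<rat>"
  shows "\<exists>x y :: int. y \<noteq> 0 \<and> x\<^sup>2 - D * y\<^sup>2 = 1"
proof -
  let ?\<theta> = "sqrt (of_int D)"
  define A where "A = approx_set ?\<theta>"
  have infA: "infinite A"
    using irr rational_iff_finite_approx_set unfolding A_def by blast
  define nrm where "nrm = (\<lambda>(h::int, k::int). h\<^sup>2 - D * k\<^sup>2)"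
  \<comment> \<open>One factor of the norm is below \<open>1/k\<close>, the other at most
    \<open>k (2 sqrt D + 1)\<close>, so \<open>k\<close> cancels.\<close>
  define B where "B = \<lceil>2 * ?\<theta> + 1\<rceil>"
  have nrm_nz: "nrm (h, k) \<noteq> 0" if "(h, k) \<in> A" for h k
  proof
    assume "nrm (h, k) = 0"
    hence "real_of_int (h\<^sup>2) = of_int (D * k\<^sup>2)" by (simp add: nrm_def)
    moreover have k: "k > 0" using that by (auto simp: A_def approx_set_def)
    ultimately have "of_int D = (of_int h / of_int k :: real)\<^sup>2"
      by (simp add: power_divide field_simps)
    hence "?\<theta> = \<bar>of_int h / of_int k\<bar>" by simp
    thus False using irr by auto
  qed
  have nrm_bound: "\<bar>nrm (h, k)\<bar> \<le> B" if hk: "(h, k) \<in> A" for h k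
  proof -
    have k: "k \<ge> 1" and less: "\<bar>?\<theta> - of_int h / of_int k\<bar> < 1 / (of_int k)\<^sup>2"
      using hk by (auto simp: A_def approx_set_def)
    let ?k = "of_int k :: real" and ?h = "of_int h :: real"
    have k1: "?k \<ge> 1" using k by simp
    have "?k * \<bar>?\<theta> - ?h / ?k\<bar> = \<bar>?k * (?\<theta> - ?h / ?k)\<bar>" using k1 by (simp add: abs_mult)
    also have "?k * (?\<theta> - ?h / ?k) = ?k * ?\<theta> - ?h" using k1 by (simp add: field_simps)
    finally have "?k * \<bar>?\<theta> - ?h / ?k\<bar> = \<bar>?k * ?\<theta> - ?h\<bar>" .
    moreover have "?k * \<bar>?\<theta> - ?h / ?k\<bar> < ?k * (1 / ?k\<^sup>2)"
      using less k1 by (intro mult_strict_left_mono) auto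
    ultimately have l: "\<bar>?k * ?\<theta> - ?h\<bar> < 1 / ?k"
      using k1 by (simp add: power2_eq_square)
    have "1 / ?k \<le> 1" "0 \<le> ?k * ?\<theta>" using k1 D by simp_all
    hence "\<bar>?h + ?k * ?\<theta>\<bar> \<le> 2 * ?k * ?\<theta> + 1"
      using l by linarith
    also have "\<dots> \<le> ?k * (2 * ?\<theta> + 1)" using k1 by (simp add: algebra_simps)
    finally have u: "\<bar>?h + ?k * ?\<theta>\<bar> \<le> ?k * (2 * ?\<theta> + 1)" .
    have "of_int (nrm (h, k)) = (?h - ?k * ?\<theta>) * (?h + ?k * ?\<theta>)"
      using D by (simp add: nrm_def algebra_simps power2_eq_square)
    hence "\<bar>of_int (nrm (h, k))\<bar> = \<bar>?k * ?\<theta> - ?h\<bar> * \<bar>?h + ?k * ?\<theta>\<bar>"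
      by (simp add: abs_mult abs_minus_commute)
    also have "\<dots> \<le> (1 / ?k) * (?k * (2 * ?\<theta> + 1))"
      using l u k1 by (intro mult_mono) auto
    also have "\<dots> = 2 * ?\<theta> + 1" using k1 by simp
    also have "\<dots> \<le> of_int B" by (simp add: B_def)
    finally show ?thesis by linarith
  qed
  \<comment> \<open>The modulus varies with the pair, but the norm is itself a component, so pairs
    with equal \<open>F\<close> share one modulus.\<close>
  define F where "F = (\<lambda>(h, k). (nrm (h, k), h mod \<bar>nrm (h, k)\<bar>, k mod \<bar>nrm (h, k)\<bar>))"
  have "F ` A \<subseteq> {-B..B} \<times> {0..B} \<times> {0..B}"
  proof
    fix t assume "t \<in> F ` A"
    then obtain h k where hk: "(h, k) \<in> A" and t: "t = F (h, k)" by auto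
    have n: "\<bar>nrm (h, k)\<bar> > 0" using nrm_nz[OF hk] by simp
    have "0 \<le> m mod \<bar>nrm (h, k)\<bar> \<and> m mod \<bar>nrm (h, k)\<bar> \<le> B" for m
      using pos_mod_bound[OF n, of m] pos_mod_sign[OF n, of m] nrm_bound[OF hk] by linarith
    thus "t \<in> {-B..B} \<times> {0..B} \<times> {0..B}"
      using nrm_bound[OF hk] by (auto simp: t F_def abs_le_iff)
  qed
  hence "finite (F ` A)" by (rule finite_subset) auto
  from pigeonhole_infinite[OF infA this] obtain p where p: "p \<in> A"
    and inf: "infinite {q \<in> A. F q = F p}" by auto
  from inf have "infinite ({q \<in> A. F q = F p} - {p})" by simp
  then obtain q where q: "q \<in> A" "F q = F p" "q \<noteq> p"
    using infinite_imp_nonempty by blast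
  obtain h k where hk: "p = (h, k)" by fastforce
  obtain h' k' where hk': "q = (h', k')" by fastforce
  define N where "N = nrm p"
  have N: "h\<^sup>2 - D * k\<^sup>2 = N" "h'\<^sup>2 - D * k'\<^sup>2 = N"
    and cong: "h' mod \<bar>N\<bar> = h mod \<bar>N\<bar>" "k' mod \<bar>N\<bar> = k mod \<bar>N\<bar>"
    using q(2) by (auto simp: F_def hk hk' N_def nrm_def)
  have N0: "N \<noteq> 0" using nrm_nz p by (simp add: N_def hk)
  have "N dvd h' - h" "N dvd k' - k"
    using cong by (simp_all add: mod_eq_dvd_iff)
  then obtain \<alpha> \<beta> where \<alpha>: "h' = h + N * \<alpha>" and \<beta>: "k' = k + N * \<beta>"
    by (metis add.commute diff_add_cancel dvdE)
  \<comment> \<open>\<open>x + y sqrt D\<close> is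
    \<open>(h - k sqrt D) (h' + k' sqrt D) / N\<close>; the congruences clear the division by
    \<open>N\<close>.\<close>
  define x where "x = 1 + h * \<alpha> - D * k * \<beta>"
  define y where "y = h * \<beta> - k * \<alpha>"
  have x: "N * x = h * h' - D * k * k'" and y: "N * y = h * k' - k * h'"
    using N(1) by (auto simp: x_def y_def \<alpha> \<beta> algebra_simps power2_eq_square)
  have "N\<^sup>2 * (x\<^sup>2 - D * y\<^sup>2) = (N * x)\<^sup>2 - D * (N * y)\<^sup>2"
    by (simp add: algebra_simps power2_eq_square)
  also have "\<dots> = (h\<^sup>2 - D * k\<^sup>2) * (h'\<^sup>2 - D * k'\<^sup>2)"
    unfolding x y by (simp add: algebra_simps power2_eq_square)
  also have "\<dots> = N\<^sup>2 * 1" unfolding N by (simp add: power2_eq_square)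
  finally have "x\<^sup>2 - D * y\<^sup>2 = 1" using N0 by simp
  \<comment> \<open>Otherwise \<open>h/k = h'/k'\<close>, and reduced fractions with positive
    denominators are equal only as pairs.\<close>
  moreover have "y \<noteq> 0"
  proof
    assume "y = 0"
    hence eq: "h * k' = h' * k" using y by simp
    have pos: "k > 0" "k' > 0" and cop: "coprime h k" "coprime h' k'"
      using p q(1) by (auto simp: A_def approx_set_def hk hk')
    have "k dvd k'"
      using eq cop(1) by (metis coprime_commute coprime_dvd_mult_right_iff dvd_triv_right)
    moreover have "k' dvd k"
      using eq cop(2) by (metis coprime_commute coprime_dvd_mult_right_iff dvd_triv_right)
    ultimately have "k = k'" using pos by (simp add: zdvd_antisym_nonneg)
    thus False using eq pos q(3) hk hk' by simp
  qed
  ultimately show ?thesis by blast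
qed

section \<open>Sums of three unit fractions in subrings of the complex numbers\<close>

text \<open>A plain subset of the complex numbers lets the identities be checked with field
  division, leaving only membership of the denominators to closure rules.\<close>

locale complex_subring =
  fixes R :: "complex set"
  assumes one_closed: "1 \<in> R"
    and diff_closed: "a \<in> R \<Longrightarrow> b \<in> R \<Longrightarrow> a - b \<in> R"
    and mult_closed: "a \<in> R \<Longrightarrow> b \<in> R \<Longrightarrow> a * b \<in> R"
begin

lemma zero_closed: "0 \<in> R"
  using diff_closed[OF one_closed one_closed] by simp

lemma uminus_closed: "a \<in> R \<Longrightarrow> - a \<in> R"
  using diff_closed[OF zero_closed] by fastforce

lemma add_closed: "a \<in> R \<Longrightarrow> b \<in> R \<Longrightarrow> a + b \<in> R"
  using diff_closed[of a "- b"] uminus_closed by simp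

lemma of_int_closed: "of_int k \<in> R"
  by (induction k rule: int_induct[where k = 0])
    (auto simp: zero_closed add_closed diff_closed one_closed)

lemma numeral_closed: "numeral k \<in> R"
  using of_int_closed[of "numeral k"] by simp

lemma power_closed: "a \<in> R \<Longrightarrow> a ^ k \<in> R"
  by (induction k) (auto simp: one_closed mult_closed)

lemmas ring_closed = zero_closed one_closed numeral_closed of_int_closed
  uminus_closed add_closed diff_closed mult_closed power_closed

definition decomposable :: "complex \<Rightarrow> bool" where
  "decomposable n \<longleftrightarrow> (\<exists>a\<in>R. \<exists>b\<in>R. \<exists>c\<in>R.
     a \<noteq> 0 \<and> b \<noteq> 0 \<and> c \<noteq> 0 \<and> 4 / n = 1 / a + 1 / b + 1 / c)"

lemma decomposableI:
  "\<lbrakk>a \<in> R; b \<in> R; c \<in> R; a \<noteq> 0; b \<noteq> 0; c \<noteq> 0; 4 / n = 1 / a + 1 / b + 1 / c\<rbrakk> \<Longrightarrow> decomposable n"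
  unfolding decomposable_def by blast

lemma decomposable_uminus:
  assumes "decomposable n"
  shows "decomposable (- n)"
proof -
  obtain a b c where abc: "a \<in> R" "b \<in> R" "c \<in> R" "a \<noteq> 0" "b \<noteq> 0" "c \<noteq> 0"
    and eq: "4 / n = 1 / a + 1 / b + 1 / c"
    using assms unfolding decomposable_def by blast
  have "4 / (- n) = 1 / (- a) + 1 / (- b) + 1 / (- c)"
    using eq by simp
  thus ?thesis using abc by (intro decomposableI[of "- a" "- b" "- c"]) (auto intro: ring_closed)
qed

section \<open>Residue classes modulo 4 with finitely many exceptions\<close>

definition good_residue :: "complex \<Rightarrow> bool" where
  "good_residue \<rho> \<longleftrightarrow> finite {z \<in> R. \<not> decomposable (4 * z + \<rho>)}"

lemma good_residueI:
  assumes "finite Z" and "\<And>z. z \<in> R \<Longrightarrow> z \<notin> Z \<Longrightarrow> decomposable (4 * z + \<rho>)"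
  shows "good_residue \<rho>"
  unfolding good_residue_def by (rule finite_subset[OF _ assms(1)]) (use assms(2) in blast)

lemma good_residue_uminus:
  assumes "good_residue \<rho>"
  shows "good_residue (- \<rho>)"
proof (rule good_residueI)
  show "finite (uminus ` {z \<in> R. \<not> decomposable (4 * z + \<rho>)})"
    using assms unfolding good_residue_def by simp
next
  fix z assume z: "z \<in> R" "z \<notin> uminus ` {z \<in> R. \<not> decomposable (4 * z + \<rho>)}"
  hence "decomposable (4 * (- z) + \<rho>)"
    using uminus_closed[OF z(1)] by (metis (mono_tags, lifting) imageI mem_Collect_eq minus_minus)
  from decomposable_uminus[OF this] show "decomposable (4 * z + - \<rho>)" by simp
qed

text \<open>Moves a class into the window of representatives used below, as when
  \<open>\<omega> - 2\<close> becomes \<open>\<omega> + 2\<close>.\<close>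

lemma good_residue_shift:
  assumes "good_residue \<rho>" "\<sigma> \<in> R"
  shows "good_residue (\<rho> + 4 * \<sigma>)"
proof (rule good_residueI)
  show "finite ((\<lambda>z. z - \<sigma>) ` {z \<in> R. \<not> decomposable (4 * z + \<rho>)})"
    using assms(1) unfolding good_residue_def by simp
next
  fix z assume z: "z \<in> R" "z \<notin> (\<lambda>z. z - \<sigma>) ` {z \<in> R. \<not> decomposable (4 * z + \<rho>)}"
  hence "decomposable (4 * (z + \<sigma>) + \<rho>)"
    using add_closed[OF z(1) assms(2)]
    by (metis (mono_tags, lifting) add_diff_cancel_right' imageI mem_Collect_eq)
  thus "decomposable (4 * z + (\<rho> + 4 * \<sigma>))" by (simp add: algebra_simps)
qed

lemma good_residue_even:
  assumes "\<sigma> \<in> R"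
  shows "good_residue (2 * \<sigma>)"
proof (rule good_residueI)
  \<comment> \<open>Exceptional sets collect the \<open>z\<close> at which a denominator vanishes,
    here \<open>2 z + \<sigma>\<close>.\<close>
  show "finite {- \<sigma> / 2}" by simp
next
  fix z assume z: "z \<in> R" "z \<notin> {- \<sigma> / 2}"
  define m where "m = 2 * z + \<sigma>"
  have m: "m \<in> R" "m \<noteq> 0"
    using z assms by (auto simp: m_def field_simps eq_neg_iff_add_eq_0 intro!: ring_closed)
  have "4 / (2 * m) = 1 / m + 1 / (2 * m) + 1 / (2 * m)" using m by (simp add: field_simps)
  hence "decomposable (2 * m)"
    using m by (intro decomposableI[of m "2 * m" "2 * m"]) (auto intro!: ring_closed)
  thus "decomposable (4 * z + 2 * \<sigma>)" by (simp add: m_def)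
qed

text \<open>Since \<open>4 q (q + w) = n^2 - w^2\<close> for \<open>n = 2 q + w\<close>, the sum
  \<open>1/q + 1/(q + w)\<close> differs from \<open>4/n\<close> by
  \<open>w^2/(n q (q + w))\<close>. As \<open>w\<close> is a unit, its square moves into the
  denominator. The multiple \<open>2 \<sigma>\<close> is absorbed by \<open>q\<close>, so a unit
  settles its whole class modulo 2.\<close>

lemma good_residue_unit:
  assumes "\<sigma> \<in> R" "w \<in> R" "v \<in> R" and wv: "w * v = 1"
  shows "good_residue (2 * \<sigma> + w)"
proof (rule good_residueI)
  \<comment> \<open>These are the zeros of \<open>q\<close>, \<open>q + w\<close> and
    \<open>n\<close>.\<close>
  show "finite {- \<sigma> / 2, - (\<sigma> + w) / 2, - (2 * \<sigma> + w) / 4}" by simp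
next
  fix z assume z: "z \<in> R" "z \<notin> {- \<sigma> / 2, - (\<sigma> + w) / 2, - (2 * \<sigma> + w) / 4}"
  define q where "q = 2 * z + \<sigma>"
  define n where "n = 2 * q + w"
  have q: "q \<in> R" "q + w \<in> R" and n: "n \<in> R"
    using z assms by (auto simp: n_def q_def intro!: ring_closed)
  have nz: "q \<noteq> 0" "q + w \<noteq> 0" "n \<noteq> 0"
    using z by (auto simp: n_def q_def field_simps eq_neg_iff_add_eq_0)
  have v: "v \<noteq> 0" using wv by auto
  have "4 / n = 1 / q + 1 / (q + w) - w\<^sup>2 / (n * q * (q + w))"
    using nz by (simp add: divide_simps) (simp add: n_def algebra_simps power2_eq_square)
  also have "w = 1 / v" using wv v by (simp add: field_simps)
  hence "w\<^sup>2 / (n * q * (q + w)) = 1 / (n * q * (q + w) * v\<^sup>2)"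
    by (simp add: power_divide)
  finally have "4 / n = 1 / q + 1 / (q + w) + 1 / (- (n * q * (q + w) * v\<^sup>2))" by simp
  moreover have "n = 4 * z + (2 * \<sigma> + w)" by (simp add: n_def q_def)
  ultimately show "decomposable (4 * z + (2 * \<sigma> + w))"
    using q n nz v \<open>v \<in> R\<close>
    by (intro decomposableI[of q "q + w" "- (n * q * (q + w) * v\<^sup>2)"]) (auto intro!: ring_closed)
qed

text \<open>Here \<open>4 a + w = w t\<close> with \<open>t = a v + 1\<close>, so
  \<open>4/n = v/t = (t - 1)/(a t) = 1/a - 1/(a t)\<close>; halving the last fraction gives three
  terms.\<close>

lemma good_residue_dvd4:
  assumes "w \<in> R" "v \<in> R" and wv: "w * v = 4"
  shows "good_residue w"
proof (rule good_residueI)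
  show "finite {0, - 1 / v}" by simp
next
  fix a assume a: "a \<in> R" "a \<notin> {0, - 1 / v}"
  have nz: "w \<noteq> 0" "v \<noteq> 0" "a \<noteq> 0" using wv a by auto
  define t where "t = a * v + 1"
  have t: "t \<in> R" "t \<noteq> 0"
    using a assms nz by (auto simp: t_def field_simps eq_neg_iff_add_eq_0 intro!: ring_closed)
  have n: "4 * a + w = w * t" using wv by (simp add: t_def algebra_simps)
  have "4 / (w * t) = v / t" using wv nz t by (simp add: field_simps)
  also have "\<dots> = 1 / a - 1 / (a * t)" using nz t by (simp add: divide_simps) (simp add: t_def)
  also have "1 / (a * t) = - 1 / (- (a * t))" by simp
  also have "\<dots> = - (1 / (- (2 * a * t)) + 1 / (- (2 * a * t)))"
    using nz t by (simp add: field_simps)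
  finally have "4 / (w * t) = 1 / a + 1 / (- (2 * a * t)) + 1 / (- (2 * a * t))" by simp
  thus "decomposable (4 * a + w)"
    unfolding n using a t nz
    by (intro decomposableI[of a "- (2 * a * t)" "- (2 * a * t)"]) (auto intro!: ring_closed)
qed

text \<open>Put \<open>r = s f\<close> and \<open>n = 4 a - r\<close>. Then
  \<open>4/n - 1/a = r/(a n)\<close>, and \<open>\<theta> r = 4 + s\<close> yields
  \<open>n + s a = r (\<theta> a - 1)\<close>, which splits this remainder into
  \<open>1/(a (\<theta> a - 1))\<close> and \<open>s/(n (\<theta> a - 1))\<close>. As
  \<open>s\<close> divides both 4 and \<open>r\<close>, \<open>n = s t\<close> and the last term is
  a unit fraction.\<close>

lemma good_residue_dvd4_add:
  assumes "s \<in> R" "e \<in> R" "f \<in> R" "\<theta> \<in> R" and "s * e = 4" "s \<noteq> - 4"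
    and \<theta>: "\<theta> * (s * f) = 4 + s"
  shows "good_residue (- (s * f))"
proof (rule good_residueI)
  \<comment> \<open>These are the zeros of \<open>a\<close>, \<open>\<theta> a - 1\<close> and
    \<open>n\<close>; \<open>t\<close> vanishes only with \<open>n\<close>.\<close>
  show "finite {0, 1 / \<theta>, s * f / 4}" by simp
next
  fix a assume a: "a \<in> R" "a \<notin> {0, 1 / \<theta>, s * f / 4}"
  define n where "n = 4 * a - s * f"
  define t where "t = e * a - f"
  have s: "s \<noteq> 0" using assms(5) by auto
  have "\<theta> \<noteq> 0" using \<theta> assms(6) by (auto simp: add_eq_0_iff)
  have n: "n = s * t" using assms(5) by (simp add: n_def t_def algebra_simps)
  have nz: "a \<noteq> 0" "n \<noteq> 0" "t \<noteq> 0" "\<theta> * a - 1 \<noteq> 0"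
    using a \<open>\<theta> \<noteq> 0\<close> n by (auto simp: n_def field_simps)
  have cl: "a \<in> R" "t \<in> R" "\<theta> * a - 1 \<in> R"
    using a assms by (auto simp: t_def intro!: ring_closed)
  have key: "n + s * a = s * f * (\<theta> * a - 1)"
  proof -
    have "n + s * a = (4 + s) * a - s * f" by (simp add: n_def algebra_simps)
    thus ?thesis unfolding \<theta>[symmetric] by (simp add: algebra_simps)
  qed
  have "1 / (a * (\<theta> * a - 1)) + 1 / (t * (\<theta> * a - 1)) = (n + s * a) / (a * n * (\<theta> * a - 1))"
    using nz s unfolding n by (simp add: divide_simps) (simp add: algebra_simps)
  also have "\<dots> = s * f / (a * n)" unfolding key using nz by simp
  also have "\<dots> = 4 / n - 1 / a" using nz by (simp add: divide_simps) (simp add: n_def)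
  finally have "4 / n = 1 / a + 1 / (a * (\<theta> * a - 1)) + 1 / (t * (\<theta> * a - 1))"
    by (simp add: algebra_simps)
  hence "decomposable n"
    using nz cl by (intro decomposableI[of a "a * (\<theta> * a - 1)" "t * (\<theta> * a - 1)"])
      (auto intro!: ring_closed)
  thus "decomposable (4 * a + - (s * f))" by (simp add: n_def)
qed

text \<open>Sixteen classes modulo 4 cover the ring. Representatives close to 0 let negation
  identify most of them in pairs.\<close>

lemma finite_not_decomposable:
  assumes "\<omega> \<in> R"
    and span: "\<And>z. z \<in> R \<Longrightarrow> \<exists>x y :: int. z = of_int x + of_int y * \<omega>"
    and good: "\<And>i j :: int. i \<in> {-1, 0, 1, 2} \<Longrightarrow> j \<in> {-1, 0, 1, 2}
      \<Longrightarrow> good_residue (of_int i + of_int j * \<omega>)"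
  shows "finite {n \<in> R. \<not> decomposable n}"
proof (rule finite_subset)
  let ?\<rho> = "\<lambda>(i, j). of_int i + of_int j * \<omega>"
  let ?I = "{-1, 0, 1, 2 :: int}"
  let ?U = "\<Union>p \<in> ?I \<times> ?I. (\<lambda>z. 4 * z + ?\<rho> p) ` {z \<in> R. \<not> decomposable (4 * z + ?\<rho> p)}"
  show "finite ?U"
    by (intro finite_UN_I finite_imageI) (use good in \<open>auto simp: good_residue_def\<close>)
  show "{n \<in> R. \<not> decomposable n} \<subseteq> ?U"
  proof
    fix n assume "n \<in> {n \<in> R. \<not> decomposable n}"
    hence n: "n \<in> R" "\<not> decomposable n" by auto
    from span[OF n(1)] obtain x y where xy: "n = of_int x + of_int y * \<omega>" by blast
    have split4: "\<exists>q i. m = 4 * q + i \<and> i \<in> ?I" for m :: int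
      by (simp, presburger)
    obtain q i where x: "x = 4 * q + i" "i \<in> ?I" using split4[of x] by blast
    obtain q' j where y: "y = 4 * q' + j" "j \<in> ?I" using split4[of y] by blast
    define z where "z = of_int q + of_int q' * \<omega>"
    have "z \<in> R" using assms(1) by (auto simp: z_def intro!: ring_closed)
    moreover have "n = 4 * z + ?\<rho> (i, j)" by (simp add: xy x(1) y(1) z_def algebra_simps)
    ultimately show "n \<in> ?U" using n(2) x(2) y(2) by blast
  qed
qed

section \<open>Residue tables for the five imaginary rings\<close>

lemma good_residue_even_coords:
  assumes "\<omega> \<in> R" "even i" "even j"
  shows "good_residue (of_int i + of_int j * \<omega>)"
proof -
  obtain k l where kl: "i = 2 * k" "j = 2 * l" using assms(2,3) by blast
  have "good_residue (2 * (of_int k + of_int l * \<omega>))"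
    using assms(1) by (intro good_residue_even) (auto intro!: ring_closed)
  thus ?thesis by (simp add: kl algebra_simps)
qed

lemma good_residue_unit_coords:
  assumes "\<omega> \<in> R" "v \<in> R" and v: "(of_int a + of_int b * \<omega>) * v = 1"
    and "even (i - a)" "even (j - b)"
  shows "good_residue (of_int i + of_int j * \<omega>)"
proof -
  obtain k l where "i - a = 2 * k" "j - b = 2 * l" using assms(4,5) by blast
  hence kl: "i = a + 2 * k" "j = b + 2 * l" by simp_all
  have "good_residue (2 * (of_int k + of_int l * \<omega>) + (of_int a + of_int b * \<omega>))"
    using assms(1,2) by (intro good_residue_unit[OF _ _ _ v]) (auto intro!: ring_closed)
  thus ?thesis by (simp add: kl algebra_simps)
qed

text \<open>Gaussian integers: the units 1 and \<open>\<omega>\<close> settle the classes with one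
  odd coordinate. Two odd coordinates give elements of norm 2, whose product with twice the
  conjugate is 4.\<close>

lemma good_residues_disc_m4:
  assumes \<omega>: "\<omega> \<in> R" "\<omega> * \<omega> = - 1" and ij: "i \<in> {-1, 0, 1, 2}" "j \<in> {-1, 0, 1, 2}"
  shows "good_residue (of_int i + of_int j * \<omega>)"
proof -
  consider "even i" "even j" | "odd i" "even j" | "even i" "odd j" | "i \<in> {-1, 1}" "j \<in> {-1, 1}"
    using ij by auto
  thus ?thesis
  proof cases
    case 1 thus ?thesis by (rule good_residue_even_coords[OF \<omega>(1)])
  next
    case 2 thus ?thesis
      by (intro good_residue_unit_coords[OF \<omega>(1) one_closed, of 1 0]) auto
  next
    case 3 thus ?thesis
      by (intro good_residue_unit_coords[OF \<omega>(1), of "- \<omega>" 0 1]) (auto simp: \<omega> ring_closed)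
  next
    case 4
    hence sq: "i * i = 1" "j * j = 1" by auto
    have "(of_int i + of_int j * \<omega>) * (2 * (of_int i - of_int j * \<omega>))
        = 2 * (of_int (i * i) - of_int (j * j) * (\<omega> * \<omega>))" by (simp add: algebra_simps)
    also have "\<dots> = 4" unfolding sq \<omega>(2) by simp
    finally have "(of_int i + of_int j * \<omega>) * (2 * (of_int i - of_int j * \<omega>)) = 4" .
    thus ?thesis using \<omega>(1) by (intro good_residue_dvd4) (auto intro!: ring_closed)
  qed
qed

text \<open>With \<open>\<omega>\<close> a square root of -2 and \<open>j\<close> odd,
  representatives of norm 2 divide 4, those of norm 3 use \<open>s = -1\<close>, and those of norm 6
  use \<open>s = \<omega>\<close> or \<open>s = - \<omega>\<close>, all up to sign.\<close>

lemma good_residues_disc_m8: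
  assumes \<omega>: "\<omega> \<in> R" "\<omega> * \<omega> = - 2" and ij: "i \<in> {-1, 0, 1, 2}" "j \<in> {-1, 0, 1, 2}"
  shows "good_residue (of_int i + of_int j * \<omega>)"
proof -
  have "\<omega> * (\<omega> * 2) = 2 * (\<omega> * \<omega>)" by simp
  also have "\<dots> = - 4" unfolding \<omega>(2) by simp
  finally have \<omega>_2\<omega>: "\<omega> * (\<omega> * 2) = - 4" .
  have "\<omega> * (- 2 * \<omega>) = 4" by (simp add: algebra_simps \<omega>_2\<omega>)
  from good_residue_dvd4[OF _ _ this] have "good_residue \<omega>"
    using \<omega>(1) by (auto intro!: ring_closed)
  note ramified = this good_residue_uminus[OF this]
  \<comment> \<open>The factorisation behind this is
    \<open>4 - \<omega> = (1 - \<omega>) (2 + \<omega>)\<close>; \<open>two_minus\<close> uses its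
    conjugate.\<close>
  have "good_residue (- (- \<omega> * (\<omega> - 1)))"
    by (rule good_residue_dvd4_add[of _ "2 * \<omega>" _ "1 - \<omega>"])
      (use \<omega> in \<open>auto simp: algebra_simps \<omega>_2\<omega> intro!: ring_closed\<close>)
  hence "good_residue (- \<omega> - 2)" using \<omega>(2) by (simp add: algebra_simps)
  note two_plus = this good_residue_uminus[OF this]
  have "good_residue (- (\<omega> * (- \<omega> - 1)))"
    by (rule good_residue_dvd4_add[of _ "- 2 * \<omega>" _ "1 + \<omega>"])
      (use \<omega> in \<open>auto simp: algebra_simps \<omega>_2\<omega> intro!: ring_closed\<close>)
  hence "good_residue (\<omega> - 2)" using \<omega>(2) by (simp add: algebra_simps)
  note two_minus = this good_residue_uminus[OF this]
  have "good_residue (- (- 1 * (- 1 - \<omega>)))"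
    by (rule good_residue_dvd4_add[of _ "- 4" _ "1 - \<omega>"])
      (use \<omega> in \<open>auto simp: algebra_simps \<omega>_2\<omega> intro!: ring_closed\<close>)
  hence "good_residue (- 1 - \<omega>)" by (simp add: algebra_simps)
  note one_plus = this good_residue_uminus[OF this]
  have "good_residue (- (- 1 * (- 1 + \<omega>)))"
    by (rule good_residue_dvd4_add[of _ "- 4" _ "1 + \<omega>"])
      (use \<omega> in \<open>auto simp: algebra_simps \<omega>_2\<omega> intro!: ring_closed\<close>)
  hence "good_residue (- 1 + \<omega>)" by (simp add: algebra_simps)
  note one_minus = this good_residue_uminus[OF this]
  consider "even i" "even j" | "odd i" "even j" | "i \<in> {-1, 0, 1, 2}" "j \<in> {-1, 1}"
    using ij by auto
  thus ?thesis
  proof cases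
    case 1 thus ?thesis by (rule good_residue_even_coords[OF \<omega>(1)])
  next
    case 2 thus ?thesis
      by (intro good_residue_unit_coords[OF \<omega>(1) one_closed, of 1 0]) auto
  next
    case 3 thus ?thesis
      using ramified two_plus two_minus one_plus one_minus by (auto simp: algebra_simps)
  qed
qed

text \<open>In the Eisenstein integers 2 is inert, and the units 1, \<open>\<omega>\<close> and
  \<open>1 - \<omega>\<close> represent the three nonzero classes modulo 2.\<close>

lemma good_residues_disc_m3:
  assumes \<omega>: "\<omega> \<in> R" "\<omega> * \<omega> = \<omega> - 1"
  shows "good_residue (of_int i + of_int j * \<omega>)"
proof -
  consider "even i" "even j" | "odd i" "even j" | "even i" "odd j" | "odd i" "odd j" by blast
  thus ?thesis
  proof cases
    case 1 thus ?thesis by (rule good_residue_even_coords[OF \<omega>(1)])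
  next
    case 2 thus ?thesis
      by (intro good_residue_unit_coords[OF \<omega>(1) one_closed, of 1 0]) auto
  next
    case 3 thus ?thesis
      by (intro good_residue_unit_coords[OF \<omega>(1), of "1 - \<omega>" 0 1])
        (auto simp: \<omega> algebra_simps intro!: ring_closed)
  next
    case 4 thus ?thesis
      by (intro good_residue_unit_coords[OF \<omega>(1), of "\<omega>" 1 "- 1"])
        (auto simp: \<omega> algebra_simps)
  qed
qed

text \<open>Here \<open>2 = \<omega> (1 - \<omega>)\<close> splits. Up to sign, every class with odd
  \<open>j\<close> contains one of the divisors \<open>\<omega>\<close>,
  \<open>1 - \<omega>\<close>, \<open>\<omega>^2 = \<omega> - 2\<close>,
  \<open>(1 - \<omega>)^2 = - 1 - \<omega>\<close> of 4.\<close>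

lemma good_residues_disc_m7:
  assumes \<omega>: "\<omega> \<in> R" "\<omega> * \<omega> = \<omega> - 2" and ij: "i \<in> {-1, 0, 1, 2}" "j \<in> {-1, 0, 1, 2}"
  shows "good_residue (of_int i + of_int j * \<omega>)"
proof -
  have "\<omega> * (2 * (1 - \<omega>)) = 2 * (\<omega> - \<omega> * \<omega>)" by (simp add: algebra_simps)
  also have "\<dots> = 4" unfolding \<omega>(2) by simp
  finally have prod: "\<omega> * (2 * (1 - \<omega>)) = 4" .
  from good_residue_dvd4[OF _ _ this] have "good_residue \<omega>"
    using \<omega>(1) by (auto intro!: ring_closed)
  note prime = this good_residue_uminus[OF this]
  have "(1 - \<omega>) * (2 * \<omega>) = 4" using prod by (simp add: algebra_simps)
  from good_residue_dvd4[OF _ _ this] have "good_residue (1 - \<omega>)"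
    using \<omega>(1) by (auto intro!: ring_closed)
  note conj_prime = this good_residue_uminus[OF this]
  have sq: "good_residue (\<omega> - 2)"
    using \<omega> by (intro good_residue_dvd4[of _ "- 1 - \<omega>"]) (auto simp: algebra_simps intro!: ring_closed)
  have "good_residue (- 1 - \<omega>)"
    using \<omega> by (intro good_residue_dvd4[of _ "\<omega> - 2"]) (auto simp: algebra_simps intro!: ring_closed)
  note conj_sq = this good_residue_uminus[OF this]
  have "good_residue (2 + \<omega>)" "good_residue (2 - \<omega>)"
    using good_residue_shift[OF sq one_closed] good_residue_uminus[OF sq] by (simp_all add: algebra_simps)
  note specials = this prime conj_prime conj_sq
  consider "even i" "even j" | "odd i" "even j" | "i \<in> {-1, 0, 1, 2}" "j \<in> {-1, 1}"
    using ij by auto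
  thus ?thesis
  proof cases
    case 1 thus ?thesis by (rule good_residue_even_coords[OF \<omega>(1)])
  next
    case 2 thus ?thesis
      by (intro good_residue_unit_coords[OF \<omega>(1) one_closed, of 1 0]) auto
  next
    case 3 thus ?thesis using specials by (auto simp: algebra_simps)
  qed
qed

text \<open>Up to sign, the classes with odd \<open>j\<close> contain elements of norm 3, where
  \<open>s = -1\<close> fits since \<open>4 + s = 3\<close>, or of norm 5, where
  \<open>s = 1\<close> fits; \<open>\<theta>\<close> is the conjugate.\<close>

lemma good_residues_disc_m11:
  assumes \<omega>: "\<omega> \<in> R" "\<omega> * \<omega> = \<omega> - 3" and ij: "i \<in> {-1, 0, 1, 2}" "j \<in> {-1, 0, 1, 2}"
  shows "good_residue (of_int i + of_int j * \<omega>)"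
proof -
  have norm3: "good_residue (- r)" if "\<theta> \<in> R" "r \<in> R" "\<theta> * r = 3" for \<theta> r
    using good_residue_dvd4_add[of "- 1" "- 4" "- r" \<theta>] that by (simp add: ring_closed)
  have norm5: "good_residue (- r)" if "\<theta> \<in> R" "r \<in> R" "\<theta> * r = 5" for \<theta> r
    using good_residue_dvd4_add[of 1 4 r \<theta>] that by (simp add: ring_closed)
  have "good_residue (- \<omega>)" "good_residue (- (1 - \<omega>))"
    using \<omega> norm3[of "1 - \<omega>" \<omega>] norm3[of \<omega> "1 - \<omega>"]
    by (auto simp: algebra_simps intro: ring_closed)
  note threes = this this[THEN good_residue_uminus]
  have "good_residue (- (2 - \<omega>))" "good_residue (- (1 + \<omega>))"
    using \<omega> norm5[of "1 + \<omega>" "2 - \<omega>"] norm5[of "2 - \<omega>" "1 + \<omega>"]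
    by (auto simp: algebra_simps intro: ring_closed)
  note fives = this this[THEN good_residue_uminus]
  \<comment> \<open>The representative \<open>2 + \<omega>\<close> has norm 9 and is reached from
    \<open>- (2 - \<omega>)\<close> by adding 4.\<close>
  note specials = threes fives good_residue_shift[OF fives(1) one_closed]
  consider "even i" "even j" | "odd i" "even j" | "i \<in> {-1, 0, 1, 2}" "j \<in> {-1, 1}"
    using ij by auto
  thus ?thesis
  proof cases
    case 1 thus ?thesis by (rule good_residue_even_coords[OF \<omega>(1)])
  next
    case 2 thus ?thesis
      by (intro good_residue_unit_coords[OF \<omega>(1) one_closed, of 1 0]) auto
  next
    case 3 thus ?thesis using specials by (auto simp: algebra_simps)
  qed
qed

end

section \<open>Integers of quadratic fields\<close>

lemma quad_int_ring_simps:
  "carrier (quad_int_ring d) = quad_ints d" "x \<otimes>\<^bsub>quad_int_ring d\<^esub> y = x * y"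
  "x \<oplus>\<^bsub>quad_int_ring d\<^esub> y = x + y" "\<one>\<^bsub>quad_int_ring d\<^esub> = 1" "\<zero>\<^bsub>quad_int_ring d\<^esub> = 0"
  by (simp_all add: quad_int_ring_def)

text \<open>\<open>euclidean_domain\<close> contains the ring axioms, so closure of
  \<open>quad_ints d\<close> is read off the hypothesis; additive inverses supply -1.\<close>

lemma quad_ints_complex_subring:
  assumes "norm_euclidean d"
  shows "complex_subring (quad_ints d)"
proof -
  interpret E: euclidean_domain "quad_int_ring d" "\<lambda>z. nat \<lfloor>\<bar>quad_norm d z\<bar>\<rfloor>"
    using assms by (simp add: norm_euclidean_def)
  note simps = quad_int_ring_simps
  have one: "1 \<in> quad_ints d" using E.one_closed by (simp add: simps)
  have mult: "a * b \<in> quad_ints d" if "a \<in> quad_ints d" "b \<in> quad_ints d" for a b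
    using E.m_closed[of a b] that by (simp add: simps)
  have add: "a + b \<in> quad_ints d" if "a \<in> quad_ints d" "b \<in> quad_ints d" for a b
    using E.a_closed[of a b] that by (simp add: simps)
  obtain m where "m \<in> quad_ints d" "1 + m = 0"
    using E.add.r_inv_ex[of 1] one by (auto simp: simps)
  hence "- 1 \<in> quad_ints d" by (metis add_eq_0_iff)
  hence "a - b \<in> quad_ints d" if "a \<in> quad_ints d" "b \<in> quad_ints d" for a b
    using add[OF that(1) mult[OF _ that(2)], of "- 1"] by simp
  thus ?thesis by unfold_locales (use one mult in auto)
qed

lemma quad_ints_division:
  assumes "norm_euclidean d" "a \<in> quad_ints d" "b \<in> quad_ints d" "b \<noteq> 0"
  obtains q r where "q \<in> quad_ints d" "a = b * q + r"
    "r = 0 \<or> nat \<lfloor>\<bar>quad_norm d r\<bar>\<rfloor> < nat \<lfloor>\<bar>quad_norm d b\<bar>\<rfloor>"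
\<comment> \<open>\<open>euclidean_function\<close> speaks of nonzero dividends, so 0 is divided by
  hand.\<close>
proof (cases "a = 0")
  case True
  interpret complex_subring "quad_ints d" by (rule quad_ints_complex_subring[OF assms(1)])
  from that[of 0 0] True show ?thesis by (simp add: zero_closed)
next
  case False
  interpret E: euclidean_domain "quad_int_ring d" "\<lambda>z. nat \<lfloor>\<bar>quad_norm d z\<bar>\<rfloor>"
    using assms by (simp add: norm_euclidean_def)
  from E.euclidean_function[of a b] False assms that show ?thesis
    by (auto simp: quad_int_ring_simps)
qed

lemma csqrt_in_quad_ints: "csqrt (of_int d) \<in> quad_ints d"
proof -
  have "csqrt (of_int d) = of_rat 0 + of_rat 1 * csqrt (of_int d)" by simp
  thus ?thesis unfolding quad_ints_def quad_field_def by blast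
qed

lemma half_one_plus_csqrt_in_quad_ints:
  assumes "d mod 4 = 1"
  shows "(1 + csqrt (of_int d)) / 2 \<in> quad_ints d"
proof -
  let ?s = "csqrt (of_int d)"
  \<comment> \<open>\<open>m\<close> is the norm of \<open>(1 + sqrt d)/2\<close>, the constant term
    of its monic polynomial.\<close>
  define m where "m = (1 - d) div 4"
  have m: "d = 1 - 4 * m" using assms unfolding m_def by presburger
  have "(1 + ?s) / 2 = of_rat (1 / 2) + of_rat (1 / 2) * ?s"
    by (simp add: of_rat_divide add_divide_distrib)
  hence "(1 + ?s) / 2 \<in> quad_field d" unfolding quad_field_def by blast
  moreover have "algebraic_int ((1 + ?s) / 2)"
  proof
    have "(1 + ?s)\<^sup>2 = 1 + 2 * ?s + of_int d" 
      using power2_csqrt[of "of_int d"] by (simp add: power2_sum)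
    hence "((1 + ?s) / 2)\<^sup>2 - (1 + ?s) / 2 + of_int m = 0"
      by (simp add: power_divide field_simps m)
    thus "poly [:of_int m, - 1, 1:] ((1 + ?s) / 2) = 0"
      by (simp add: power2_eq_square algebra_simps)
  qed (auto simp: coeff_pCons split: nat.splits)
  ultimately show ?thesis by (simp add: quad_ints_def)
qed

section \<open>Integral coordinates in imaginary quadratic fields\<close>

lemma squarefree_mult_square_Ints:
  fixes q :: rat
  assumes "squarefree d" "of_int d * q\<^sup>2 \<in> \<int>"
  shows "q \<in> \<int>"
proof -
  obtain a b :: int where ab: "quotient_of q = (a, b)" by fastforce
  have q: "q = of_int a / of_int b" and b: "b > 0" and cop: "coprime a b"
    using quotient_of_div[OF ab] quotient_of_denom_pos[OF ab] quotient_of_coprime[OF ab] by auto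
  obtain k where "of_int d * q\<^sup>2 = of_int k" using assms(2) by (auto elim: Ints_cases)
  hence "(of_int (d * a\<^sup>2) :: rat) = of_int (k * b\<^sup>2)"
    using b by (simp add: q power_divide field_simps)
  hence "d * a\<^sup>2 = k * b\<^sup>2" by (simp only: of_int_eq_iff)
  hence "b\<^sup>2 dvd d * a\<^sup>2" by simp
  moreover have "coprime (b\<^sup>2) (a\<^sup>2)" using cop by (simp add: coprime_commute)
  ultimately have "b\<^sup>2 dvd d" by (simp add: coprime_dvd_mult_left_iff)
  hence "b dvd 1" by (rule squarefreeD[OF assms(1)])
  hence "b = 1" using b by simp
  thus ?thesis by (simp add: q)
qed

text \<open>For \<open>d < 0\<close> complex conjugation is the field conjugation, so the trace
  \<open>2 x\<close> and the norm of \<open>z\<close> lie in the ring; being rational, they are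
  integers. Then \<open>d (2 y)^2\<close> is an integer, and squarefreeness makes \<open>2 y\<close>
  one.\<close>

lemma imaginary_quad_ints_cases:
  assumes "squarefree d" "d < 0" "norm_euclidean d" "z \<in> quad_ints d"
  obtains X Y :: int where "z = (of_int X + of_int Y * csqrt (of_int d)) / 2" "4 dvd X\<^sup>2 - d * Y\<^sup>2"
proof -
  interpret complex_subring "quad_ints d" by (rule quad_ints_complex_subring[OF assms(3)])
  let ?s = "csqrt (of_int d)"
  have cnj_s: "cnj ?s = - ?s" using assms(2) by simp
  obtain x y where z: "z = of_rat x + of_rat y * ?s" and "algebraic_int z"
    using assms(4) by (auto simp: quad_ints_def quad_field_def)
  have cnj_rat: "cnj (of_rat r) = of_rat r" for r
    by (induction r) (simp add: of_rat_rat)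
  have cnj_z: "cnj z = of_rat x + of_rat (- y) * ?s"
    by (simp add: z cnj_s cnj_rat of_rat_minus)
  have "cnj z \<in> quad_ints d"
    using \<open>algebraic_int z\<close> cnj_z algebraic_int_cnj[of z]
    unfolding quad_ints_def quad_field_def by blast
  hence "z + cnj z \<in> quad_ints d" "z * cnj z \<in> quad_ints d"
    using assms(4) by (auto intro: ring_closed)
  moreover have "z + cnj z = of_rat (2 * x)"
    unfolding cnj_z by (simp add: z of_rat_minus of_rat_mult)
  moreover have "z * cnj z = of_rat (x\<^sup>2 - of_int d * y\<^sup>2)"
  proof -
    have "z * cnj z = (of_rat x)\<^sup>2 - (of_rat y)\<^sup>2 * ?s\<^sup>2"
      unfolding cnj_z by (simp add: z of_rat_minus power2_eq_square algebra_simps)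
    thus ?thesis by (simp add: of_rat_diff of_rat_mult of_rat_power)
  qed
  moreover have "r \<in> \<int>" if "of_rat r \<in> quad_ints d" for r
  proof -
    have "(of_rat r :: complex) \<in> \<int>"
      using that by (intro rational_algebraic_int_is_int) (auto simp: quad_ints_def)
    then obtain k where "(of_rat r :: complex) = of_rat (of_int k)" by (auto elim: Ints_cases)
    thus ?thesis by (simp only: of_rat_eq_iff) simp
  qed
  ultimately have "2 * x \<in> \<int>" "x\<^sup>2 - of_int d * y\<^sup>2 \<in> \<int>" by metis+
  then obtain X N where X: "2 * x = of_int X" and N: "x\<^sup>2 - of_int d * y\<^sup>2 = of_int N"
    by (auto elim!: Ints_cases)
  have "of_int d * (2 * y)\<^sup>2 = (2 * x)\<^sup>2 - 4 * (x\<^sup>2 - of_int d * y\<^sup>2)"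
    by (simp add: algebra_simps power2_eq_square)
  also have "\<dots> = of_int (X\<^sup>2 - 4 * N)" unfolding X N by simp
  finally have "of_int d * (2 * y)\<^sup>2 \<in> \<int>" by simp
  from squarefree_mult_square_Ints[OF assms(1) this] obtain Y where Y: "2 * y = of_int Y"
    by (auto elim: Ints_cases)
  have xy: "x = of_int X / 2" "y = of_int Y / 2" using X Y by simp_all
  show ?thesis
  proof
    show "z = (of_int X + of_int Y * ?s) / 2"
      by (simp add: z xy of_rat_divide add_divide_distrib)
    have "of_int (X\<^sup>2 - d * Y\<^sup>2) = (of_int (4 * N) :: rat)"
      using N by (simp add: xy power_divide field_simps)
    hence "X\<^sup>2 - d * Y\<^sup>2 = 4 * N" by (simp only: of_int_eq_iff)
    thus "4 dvd X\<^sup>2 - d * Y\<^sup>2" by simp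
  qed
qed

lemma square_mod_4: "(X::int)\<^sup>2 mod 4 = (if even X then 0 else 1)"
proof (cases "even X")
  case True
  then obtain k where "X = 2 * k" by blast
  thus ?thesis by (simp add: power2_eq_square)
next
  case False
  then obtain k where "X = 2 * k + 1" using oddE by blast
  hence "X\<^sup>2 = 1 + 4 * (k\<^sup>2 + k)" by (simp add: power2_eq_square algebra_simps)
  thus ?thesis using False by (simp only: mod_mult_self2) simp
qed

lemma squarefree_mod_4_neq_0:
  assumes "squarefree (d :: int)"
  shows "d mod 4 \<noteq> 0"
proof
  assume "d mod 4 = 0"
  hence "2\<^sup>2 dvd d" by auto
  from squarefreeD[OF assms this] show False by simp
qed

text \<open>Squares are 0 or 1 modulo 4 and \<open>d\<close> is not 0 there, so the parities agree,
  and both odd forces \<open>d mod 4 = 1\<close>.\<close>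

lemma four_dvd_norm_form_cases:
  fixes d :: int
  assumes "squarefree d" "4 dvd X\<^sup>2 - d * Y\<^sup>2"
  shows "even (X - Y)" "d mod 4 \<noteq> 1 \<Longrightarrow> even X \<and> even Y"
proof -
  have eq: "X\<^sup>2 mod 4 = (d mod 4) * (Y\<^sup>2 mod 4) mod 4"
    using assms(2) by (simp add: mod_eq_dvd_iff mod_mult_eq)
  have "d mod 4 \<in> {1, 2, 3}"
    using squarefree_mod_4_neq_0[OF assms(1)] by (simp, presburger)
  with eq show "even (X - Y)" "d mod 4 \<noteq> 1 \<Longrightarrow> even X \<and> even Y"
    by (auto simp: square_mod_4 split: if_splits)
qed

lemma imaginary_quad_ints_span_csqrt:
  assumes "squarefree d" "d < 0" "norm_euclidean d" "d mod 4 \<noteq> 1" "z \<in> quad_ints d"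
  shows "\<exists>x y :: int. z = of_int x + of_int y * csqrt (of_int d)"
proof -
  obtain X Y where z: "z = (of_int X + of_int Y * csqrt (of_int d)) / 2" "4 dvd X\<^sup>2 - d * Y\<^sup>2"
    using imaginary_quad_ints_cases[OF assms(1-3,5)] .
  obtain x y where "X = 2 * x" "Y = 2 * y"
    using four_dvd_norm_form_cases(2)[OF assms(1) z(2) assms(4)] by blast
  hence "z = of_int x + of_int y * csqrt (of_int d)" by (simp add: z(1) field_simps)
  thus ?thesis by blast
qed

lemma imaginary_quad_ints_span_half:
  assumes "squarefree d" "d < 0" "norm_euclidean d" "z \<in> quad_ints d"
  shows "\<exists>x y :: int. z = of_int x + of_int y * ((1 + csqrt (of_int d)) / 2)"
proof -
  obtain X Y where z: "z = (of_int X + of_int Y * csqrt (of_int d)) / 2" "4 dvd X\<^sup>2 - d * Y\<^sup>2"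
    using imaginary_quad_ints_cases[OF assms] .
  obtain x where "X - Y = 2 * x"
    using four_dvd_norm_form_cases(1)[OF assms(1) z(2)] by blast
  hence "X = Y + 2 * x" by simp
  hence "z = of_int x + of_int Y * ((1 + csqrt (of_int d)) / 2)" by (simp add: z(1) field_simps)
  thus ?thesis by blast
qed

section \<open>Division by 2 and the possible imaginary fields\<close>

lemma imaginary_quad_ints_remainder_mod_2:
  assumes "squarefree d" "d < 0" "norm_euclidean d"
    and "of_rat x + of_rat y * csqrt (of_int d) \<in> quad_ints d"
  obtains X Y :: int where "x - of_int X = 0 \<and> y - of_int Y = 0 \<or>
    (x - of_int X)\<^sup>2 - of_int d * (y - of_int Y)\<^sup>2 < 4" "4 dvd X\<^sup>2 - d * Y\<^sup>2"
proof -
  interpret complex_subring "quad_ints d" by (rule quad_ints_complex_subring[OF assms(3)])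
  let ?s = "csqrt (of_int d)"
  have d1: "d \<noteq> 1" using assms(2) by simp
  obtain q r where q: "q \<in> quad_ints d" and r: "of_rat x + of_rat y * ?s = 2 * q + r"
    "r = 0 \<or> nat \<lfloor>\<bar>quad_norm d r\<bar>\<rfloor> < nat \<lfloor>\<bar>quad_norm d 2\<bar>\<rfloor>"
    using quad_ints_division[OF assms(3,4) numeral_closed] by (metis zero_neq_numeral)
  obtain X Y where X: "q = (of_int X + of_int Y * ?s) / 2" "4 dvd X\<^sup>2 - d * Y\<^sup>2"
    using imaginary_quad_ints_cases[OF assms(1-3) q] .
  \<comment> \<open>Multiplying \<open>q\<close> by 2 clears its halves, so the remainder differs
    from the dividend by integer coordinates.\<close>
  have r_eq: "r = of_rat (x - of_int X) + of_rat (y - of_int Y) * ?s"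
    using r(1) by (simp add: X(1) of_rat_diff algebra_simps)
  have "quad_norm d 2 = 4"
    using quad_norm_eq[OF assms(1) d1, of 2 0] by simp
  moreover have "quad_norm d r = (x - of_int X)\<^sup>2 - of_int d * (y - of_int Y)\<^sup>2"
    unfolding r_eq by (rule quad_norm_eq[OF assms(1) d1])
  moreover have "x - of_int X = 0 \<and> y - of_int Y = 0" if "r = 0"
    using quad_coords_unique[OF assms(1) d1, of "x - of_int X" "y - of_int Y" 0 0] that r_eq by simp
  ultimately have "x - of_int X = 0 \<and> y - of_int Y = 0 \<or>
      (x - of_int X)\<^sup>2 - of_int d * (y - of_int Y)\<^sup>2 < 4"
    using r(2) by (auto simp: nat_less_iff le_nat_iff)
  with X(2) that show ?thesis by blast
qed

lemma imaginary_norm_euclidean_cases: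
  assumes "squarefree d" "d < 0" "norm_euclidean d"
  shows "d \<in> {-1, -2, -3, -7, -11}"
proof (cases "d mod 4 = 1")
  case True
  have "of_rat (1 / 2) + of_rat (1 / 2) * csqrt (of_int d) \<in> quad_ints d"
    using half_one_plus_csqrt_in_quad_ints[OF True] by (simp add: of_rat_divide add_divide_distrib)
  from imaginary_quad_ints_remainder_mod_2[OF assms this] obtain X Y :: int where
    "(1 / 2 :: rat) - of_int X = 0 \<and> (1 / 2 :: rat) - of_int Y = 0 \<or>
      (1 / 2 - of_int X)\<^sup>2 - of_int d * (1 / 2 - of_int Y)\<^sup>2 < (4 :: rat)" by blast
  \<comment> \<open>Both remainder coordinates are halves of odd integers, so the remainder is
    nonzero and its norm is at least \<open>(1 - d)/4\<close>; the bound 4 leaves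
    \<open>- d < 15\<close>.\<close>
  moreover have "(1 / 2 :: rat) - of_int X \<noteq> 0"
  proof
    assume "(1 / 2 :: rat) - of_int X = 0"
    hence "(of_int 1 :: rat) = of_int (2 * X)" by simp
    hence "1 = 2 * X" by (simp only: of_int_eq_iff)
    thus False by presburger
  qed
  ultimately have "((1 - 2 * of_int X)\<^sup>2 - of_int d * (1 - 2 * of_int Y)\<^sup>2) / 4 < (4 :: rat)"
    by (simp add: power2_eq_square field_simps)
  hence "of_int ((1 - 2 * X)\<^sup>2 - d * (1 - 2 * Y)\<^sup>2) < (of_int 16 :: rat)" by simp
  hence less: "(1 - 2 * X)\<^sup>2 - d * (1 - 2 * Y)\<^sup>2 < 16" by (simp only: of_int_less_iff)
  have odd_square: "(1 - 2 * m)\<^sup>2 \<ge> 1" for m :: int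
  proof -
    have "1 - 2 * m \<noteq> 0" by presburger
    hence "(1 - 2 * m)\<^sup>2 > 0" by simp
    thus ?thesis by linarith
  qed
  have "- d * 1 \<le> - d * (1 - 2 * Y)\<^sup>2" using assms(2) odd_square by (intro mult_left_mono) auto
  hence "- d < 15" using less odd_square[of X] by simp
  hence "d \<in> {-14..-1}" using assms(2) by simp
  with True show ?thesis by (simp, presburger)
next
  case False
  have "of_rat 0 + of_rat 1 * csqrt (of_int d) \<in> quad_ints d"
    using csqrt_in_quad_ints by simp
  from imaginary_quad_ints_remainder_mod_2[OF assms this] obtain X Y :: int where
    XY: "(0 :: rat) - of_int X = 0 \<and> (1 :: rat) - of_int Y = 0 \<or>
      (0 - of_int X)\<^sup>2 - of_int d * (1 - of_int Y)\<^sup>2 < (4 :: rat)"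
    and "4 dvd X\<^sup>2 - d * Y\<^sup>2" .
  \<comment> \<open>The quotient has integer coordinates here, so \<open>1 - Y\<close> is odd and
    the remainder has norm at least \<open>- d\<close>.\<close>
  have "even Y" using four_dvd_norm_form_cases(2)[OF assms(1) _ False] \<open>4 dvd X\<^sup>2 - d * Y\<^sup>2\<close> by blast
  hence Y: "1 - Y \<noteq> 0" by presburger
  hence "(1 :: rat) - of_int Y \<noteq> 0" by (metis of_int_1 of_int_diff of_int_eq_0_iff)
  hence "of_int (X\<^sup>2 - d * (1 - Y)\<^sup>2) < (of_int 4 :: rat)" using XY by simp
  hence "X\<^sup>2 - d * (1 - Y)\<^sup>2 < 4" by (simp only: of_int_less_iff)
  moreover have "(1 - Y)\<^sup>2 > 0" using Y by simp
  hence "(1 - Y)\<^sup>2 \<ge> 1" by linarith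
  hence "- d * 1 \<le> - d * (1 - Y)\<^sup>2" using assms(2) by (intro mult_left_mono) auto
  ultimately have "- d < 4" using zero_le_power2[of X] by linarith
  hence "d \<in> {-3..-1}" using assms(2) by simp
  with False show ?thesis by (simp, presburger)
qed

section \<open>The five imaginary and the real fields\<close>

lemma imaginary_finite_not_decomposable:
  assumes "squarefree d" "d < 0" "norm_euclidean d"
  shows "finite {n \<in> quad_ints d. \<not> complex_subring.decomposable (quad_ints d) n}"
proof -
  interpret complex_subring "quad_ints d" by (rule quad_ints_complex_subring[OF assms(3)])
  define g where "g = csqrt (of_int d)"
  define \<omega> where "\<omega> = (1 + g) / 2"
  have g: "g \<in> quad_ints d" "g * g = of_int d"
    using csqrt_in_quad_ints power2_csqrt[of "of_int d"] by (simp_all add: g_def power2_eq_square)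
  have \<omega>: "\<omega> \<in> quad_ints d" if "d mod 4 = 1"
    using half_one_plus_csqrt_in_quad_ints[OF that] by (simp add: \<omega>_def g_def)
  \<comment> \<open>\<open>m\<close> is the norm of \<open>\<omega>\<close>: 1, 2, 3 for
    \<open>d\<close> equal to -3, -7, -11.\<close>
  have \<omega>2: "\<omega> * \<omega> = \<omega> - of_int m" if "d = 1 - 4 * m" for m
  proof -
    have "\<omega> * \<omega> = (1 + 2 * g + g * g) / 4" by (simp add: \<omega>_def algebra_simps)
    also have "\<dots> = \<omega> - of_int m" unfolding g(2) that by (simp add: \<omega>_def field_simps)
    finally show ?thesis .
  qed
  note half = finite_not_decomposable[OF \<omega> imaginary_quad_ints_span_half[OF assms, folded g_def, folded \<omega>_def]]
  note int = finite_not_decomposable[OF g(1) imaginary_quad_ints_span_csqrt[OF assms, folded g_def]]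
  consider "d = -1" | "d = -2" | "d = -3" | "d = -7" | "d = -11"
    using imaginary_norm_euclidean_cases[OF assms] by blast
  thus ?thesis
  proof cases
    case 1
    show ?thesis by (rule int) (use 1 g good_residues_disc_m4 in auto)
  next
    case 2
    show ?thesis by (rule int) (use 2 g good_residues_disc_m8 in auto)
  next
    case 3
    show ?thesis by (rule half) (use 3 \<omega> \<omega>2[of 1] good_residues_disc_m3 in auto)
  next
    case 4
    show ?thesis by (rule half) (use 4 \<omega> \<omega>2[of 2] good_residues_disc_m7 in auto)
  next
    case 5
    show ?thesis by (rule half) (use 5 \<omega> \<omega>2[of 3] good_residues_disc_m11 in auto)
  qed
qed

lemma real_decomposable:
  assumes "squarefree d" "d > 1" "norm_euclidean d" "n \<in> quad_ints d" "n \<noteq> 0"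
  shows "complex_subring.decomposable (quad_ints d) n"
proof -
  interpret complex_subring "quad_ints d" by (rule quad_ints_complex_subring[OF assms(3)])
  let ?s = "csqrt (of_int d)"
  have "sqrt (of_int (4 * d)) \<notin> \<rat>"
  proof
    assume "sqrt (of_int (4 * d)) \<in> \<rat>"
    then obtain q where "sqrt (of_int (4 * d)) = of_rat q" by (auto elim: Rats_cases)
    hence "(of_rat q :: real)\<^sup>2 = of_int (4 * d)"
      using assms(2) by (metis mult_nonneg_nonneg of_int_0_le_iff order.strict_implies_order
        less_trans real_sqrt_pow2 zero_le_numeral zero_less_one)
    hence "(of_rat (q\<^sup>2) :: real) = of_rat (of_int (4 * d))"
      by (simp only: of_rat_power of_rat_of_int_eq)
    hence "q\<^sup>2 = of_int (4 * d)" by (simp only: of_rat_eq_iff)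
    hence "(q / 2)\<^sup>2 = of_int d" by (simp add: power_divide)
    from squarefree_rat_square_eq_1[OF assms(1) this] show False using assms(2) by simp
  qed
  \<comment> \<open>Solving Pell's equation for \<open>4 d\<close> makes \<open>u - v\<close>
    divisible by \<open>4 sqrt d\<close>.\<close>
  then obtain x y where y: "y \<noteq> 0" and pell: "x\<^sup>2 - 4 * d * y\<^sup>2 = 1"
    using pell_solution_exists[of "4 * d"] assms(2) by auto
  define u where "u = of_int x + 2 * of_int y * ?s"
  define v where "v = of_int x - 2 * of_int y * ?s"
  \<comment> \<open>Since \<open>u v = 1\<close>, the fractions \<open>1/(k v)\<close> and
    \<open>1/(k u)\<close> are \<open>u/k\<close> and \<open>v/k\<close>; this \<open>k\<close>
    turns their difference into \<open>4/n\<close>.\<close>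
  define k where "k = of_int y * ?s * n"
  have ss: "?s * ?s = of_int d" using power2_csqrt[of "of_int d"] by (simp add: power2_eq_square)
  have "u * v = (of_int x)\<^sup>2 - 4 * (?s * ?s) * (of_int y)\<^sup>2"
    by (simp add: u_def v_def algebra_simps power2_eq_square)
  also have "\<dots> = of_int (x\<^sup>2 - 4 * d * y\<^sup>2)" unfolding ss by simp
  finally have uv: "u * v = 1" using pell by simp
  have cl: "u \<in> quad_ints d" "v \<in> quad_ints d" "k \<in> quad_ints d"
    using csqrt_in_quad_ints[of d] assms(4) by (auto simp: u_def v_def k_def intro!: ring_closed)
  have nz: "u \<noteq> 0" "v \<noteq> 0" "k \<noteq> 0"
    using uv y assms(2,5) by (auto simp: k_def)
  have "1 / (k * v) + 1 / (- (2 * k * u)) + 1 / (- (2 * k * u)) = 1 / (k * v) - 1 / (k * u)"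
    using nz by (simp add: field_simps)
  also have "\<dots> = (u - v) / (k * (u * v))" using nz by (simp add: field_simps)
  also have "\<dots> = 4 * (of_int y * ?s) / k" unfolding uv by (simp add: u_def v_def)
  also have "\<dots> = 4 / n" using nz(3) by (simp add: k_def field_simps)
  finally show ?thesis
    using nz cl by (intro decomposableI[of "k * v" "- (2 * k * u)" "- (2 * k * u)"])
      (auto intro!: ring_closed)
qed

theorem theorem2:
  fixes d :: int
  assumes "squarefree d" and "d \<noteq> 1"
    and "norm_euclidean d"
  shows "\<exists>E. finite E \<and> E \<subseteq> quad_ints d \<and>
    (\<forall>n \<in> quad_ints d - E. \<exists>a \<in> quad_ints d. \<exists>b \<in> quad_ints d. \<exists>c \<in> quad_ints d.
       a \<noteq> 0 \<and> b \<noteq> 0 \<and> c \<noteq> 0 \<and> 4 / n = 1 / a + 1 / b + 1 / c)"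
proof -
  interpret complex_subring "quad_ints d" by (rule quad_ints_complex_subring[OF assms(3)])
  have "d \<noteq> 0" using assms(1) by auto
  then consider "d < 0" | "d > 1" using assms(2) by linarith
  hence "finite {n \<in> quad_ints d. \<not> decomposable n}"
  proof cases
    case 1
    thus ?thesis using imaginary_finite_not_decomposable assms by blast
  next
    case 2
    \<comment> \<open>Only \<open>n = 0\<close>, where the constructed \<open>k\<close> would
      vanish, is left aside.\<close>
    have "{n \<in> quad_ints d. \<not> decomposable n} \<subseteq> {0}"
      using real_decomposable[OF assms(1) 2 assms(3)] by blast
    thus ?thesis by (rule finite_subset) simp
  qed
  thus ?thesis
    by (intro exI[of _ "{n \<in> quad_ints d. \<not> decomposable n}"]) (auto simp: decomposable_def)
qed

end
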